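(* Let $N<D$, let $X\in\mathbb{R}^{N\times D}$ be a full-rank data matrix (i.e. $\operatorname{rank}X=N$) with labels $\mathbf{y}\in\{-1,+1\}^N$, such that the dataset is linearly separable, i.e. there is $\boldsymbol{\beta}^*\in\mathbb{R}^D$ with $y_n\mathbf{x}_n^\top\boldsymbol{\beta}^*\ge 1$ for all $n$, where $\mathbf{x}_n^\top$ are the rows of $X$. Let $\boldsymbol{\beta}_t$, $t\in[0,\infty)$, be the parameters of a linear model following natural gradient flow under logistic loss on $(X,\mathbf{y})$. Then the logits $\mathbf{s}_t=X\boldsymbol{\beta}_t\in\mathbb{R}^N$ follow an asymptotically linear trajectory with direction vector $\mathbf{y}$: there exist a scalar $\alpha>0$ and a constant vector $\mathbf{c}\in\mathbb{R}^N$ such that $$\lim_{t\to\infty}\bigl(\mathbf{s}_t-(\alpha t\,\mathbf{y}+\mathbf{c})\bigr)=0 .$$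
   Context: For a dataset $(X,\mathbf{y})$ with $X\in\mathbb{R}^{N\times D}$ having rows $\mathbf{x}_1^\top,\dots,\mathbf{x}_N^\top$ and $\mathbf{y}\in\{-1,+1\}^N$, the linear logistic model with parameter $\boldsymbol{\beta}\in\mathbb{R}^D$ is $p(y\mid\mathbf{x},\boldsymbol{\beta})=\frac{1}{1+e^{-y\mathbf{x}^\top\boldsymbol{\beta}}}$ for $y\in\{-1,+1\}$. Put $\ell(\boldsymbol{\beta},\mathbf{x},y)=-\log p(y\mid\mathbf{x},\boldsymbol{\beta})=\log(1+e^{-y\mathbf{x}^\top\boldsymbol{\beta}})$. The loss is $\mathcal{L}(\boldsymbol{\beta})=\sum_{n=1}^N\ell(\boldsymbol{\beta},\mathbf{x}_n,y_n)$. The (average) Fisher information matrix, averaged over the training inputs, is $$F(\boldsymbol{\beta})=\frac1N\sum_{n=1}^N\mathbb{E}_{y\sim p(\cdot\mid\mathbf{x}_n,\boldsymbol{\beta})}\left[\nabla_{\boldsymbol{\beta}}\ell(\boldsymbol{\beta},\mathbf{x}_n,y)\,\nabla_{\boldsymbol{\beta}}\ell(\boldsymbol{\beta},\mathbf{x}_n,y)^\top\right].$$ $F$ need not be invertible. A trajectory of natural gradient flow (NGF) is any differentiable curve $\boldsymbol{\beta}_t$ satisfying $F(\boldsymbol{\beta}_t)\dot{\boldsymbol{\beta}}_t=-\nabla_{\boldsymbol{\beta}}\mathcal{L}(\boldsymbol{\beta}_t)$. *)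

theory Defs
  imports "HOL-Analysis.Analysis"
begin

definition gradient :: "('a::real_inner \<Rightarrow> real) \<Rightarrow> 'a \<Rightarrow> 'a" where
  "gradient f x = (THE g. GDERIV f x :> g)"

lemma gradient_eqI:
  assumes "GDERIV f x :> g"
  shows "gradient f x = g"
  unfolding gradient_def
proof (rule the_equality)
  show "GDERIV f x :> g" by (fact assms)
next
  fix g'
  assume "GDERIV f x :> g'"
  then have "(\<lambda>h. h \<bullet> g') = (\<lambda>h. h \<bullet> g)"
    using assms has_derivative_unique unfolding gderiv_def by blast
  then show "g' = g"
    by (metis vector_eq_ldot)
qed

definition outer_product :: "real^'a \<Rightarrow> real^'b \<Rightarrow> real^'b^'a" where
  "outer_product u v = (\<chi> i j. u $ i * v $ j)"

text \<open>Labels are the real numbers \<open>-1\<close> and \<open>1\<close>. As a function of \<open>label\<close> on this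
  two-point set, \<open>logistic_prob\<close> is a probability mass function.\<close>

definition logistic_prob :: "real \<Rightarrow> real^'d \<Rightarrow> real^'d \<Rightarrow> real" where
  "logistic_prob label x \<beta> = 1 / (1 + exp (- label * (x \<bullet> \<beta>)))"

lemma logistic_prob_sum:
  "(\<Sum>label\<in>{-1, 1}. logistic_prob label x \<beta>) = 1"
proof -
  define e where "e = exp (x \<bullet> \<beta>)"
  have "e > 0" by (simp add: e_def)
  have "1 / (1 + e) + 1 / (1 + inverse e) = 1"
    using \<open>e > 0\<close> by (simp add: field_simps add_pos_pos)
  then show ?thesis
    by (simp add: logistic_prob_def exp_minus e_def)
qed

definition logistic_loss :: "real^'d \<Rightarrow> real^'d \<Rightarrow> real \<Rightarrow> real" where
  "logistic_loss \<beta> x label = - ln (logistic_prob label x \<beta>)"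

definition total_loss :: "real^'d^'n \<Rightarrow> real^'n \<Rightarrow> real^'d \<Rightarrow> real" where
  "total_loss X y \<beta> = (\<Sum>n\<in>UNIV. logistic_loss \<beta> (row n X) (y $ n))"

text \<open>The inner sum is the expectation over a label drawn from the model's own
  predictive distribution at \<open>row n X\<close>; the observed labels do not enter.\<close>

definition fisher_information :: "real^'d^'n \<Rightarrow> real^'d \<Rightarrow> real^'d^'d" where
  "fisher_information X \<beta> =
    (1 / real CARD('n)) *\<^sub>R
      (\<Sum>n\<in>UNIV. \<Sum>label\<in>{-1, 1}.
        logistic_prob label (row n X) \<beta> *\<^sub>R
          outer_product (gradient (\<lambda>b. logistic_loss b (row n X) label) \<beta>)
                        (gradient (\<lambda>b. logistic_loss b (row n X) label) \<beta>))"

definition linearly_separable :: "real^'d^'n \<Rightarrow> real^'n \<Rightarrow> bool" where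
  "linearly_separable X y \<longleftrightarrow> (\<exists>\<beta>. \<forall>n. y $ n * (row n X \<bullet> \<beta>) \<ge> 1)"

text \<open>The derivative at time \<open>0\<close> is one-sided. The Fisher matrix may be singular, so the
  velocity is constrained only through the equation and need not be determined by it.\<close>

definition natural_gradient_flow ::
  "real^'d^'n \<Rightarrow> real^'n \<Rightarrow> (real \<Rightarrow> real^'d) \<Rightarrow> bool" where
  "natural_gradient_flow X y \<beta> \<longleftrightarrow>
    (\<forall>t\<ge>0. \<exists>v. (\<beta> has_vector_derivative v) (at t within {0..}) \<and>
      fisher_information X (\<beta> t) *v v = - gradient (total_loss X y) (\<beta> t))"

end

theory Submission
  imports Defs "HOL-Real_Asymp.Real_Asymp"
begin

text \<open>Since the rows \<open>x\<^sub>n\<close> of \<open>X\<close> are linearly independent, the flow equation decouples: the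
  margins \<open>m\<^sub>n = y\<^sub>n (x\<^sub>n \<bullet> \<beta>)\<close> satisfy \<open>m\<^sub>n' = N (1 + exp (- m\<^sub>n))\<close>. Hence
  \<open>(1 + exp m\<^sub>n) exp (- N t)\<close> is conserved, and \<open>m\<^sub>n - N t\<close> converges to the
  logarithm of that constant, so that \<open>\<alpha> = N\<close>.\<close>

lemma outer_product_mult_vec: "outer_product u w *v v = (w \<bullet> v) *\<^sub>R u"
  by (simp add: vec_eq_iff outer_product_def matrix_vector_mult_def inner_vec_def
      sum_distrib_left mult_ac)

lemma sum_matrix_vector_mult:
  fixes A :: "'i \<Rightarrow> real^'a^'b"
  shows "(\<Sum>i\<in>I. A i) *v v = (\<Sum>i\<in>I. A i *v v)"
  by (induction I rule: infinite_finite_induct) (simp_all add: matrix_vector_mult_add_rdistrib)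

text \<open>Full row rank makes the transpose injective, and a combination of rows is the transpose
  applied to the coefficient vector. This allows the vector equation of the flow to be read off one
  data point at a time.\<close>

lemma sum_scaleR_row_eq_0:
  fixes X :: "real^'d^'n"
  assumes "rank X = CARD('n)" and "(\<Sum>n\<in>UNIV. u n *\<^sub>R row n X) = 0"
  shows "u n = 0"
proof -
  have "inj ((*v) (transpose X))"
    using assms(1) by (simp add: full_rank_injective[symmetric] rank_transpose)
  moreover have "transpose X *v (\<chi> n. u n) = transpose X *v 0"
    using assms(2) by (simp add: matrix_mult_sum scalar_mult_eq_scaleR column_transpose)
  ultimately have "(\<chi> n. u n) = (0::real^'n)"
    by (rule injD)
  then show ?thesis
    by (simp add: vec_eq_iff)
qed

lemma logistic_prob_uminus: "logistic_prob (- l) x \<beta> = 1 - logistic_prob l x \<beta>"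
proof -
  define e where "e = exp (l * (x \<bullet> \<beta>))"
  have "e > 0"
    by (simp add: e_def)
  then have "1 / (1 + e) = 1 - 1 / (1 + inverse e)"
    by (simp add: field_simps add_pos_pos)
  then show ?thesis
    by (simp add: logistic_prob_def exp_minus e_def)
qed

lemma logistic_prob_pos: "logistic_prob l x \<beta> > 0"
  by (simp add: logistic_prob_def add_pos_pos)

text \<open>Chain rule for the softplus \<open>ln (1 + exp (- z))\<close>: the resulting factor
  \<open>exp (- z) / (1 + exp (- z))\<close> is the probability of the opposite label.\<close>

lemma gderiv_logistic_loss:
  "GDERIV (\<lambda>b. logistic_loss b x l) \<beta> :> - (l * logistic_prob (- l) x \<beta>) *\<^sub>R x"
proof -
  have pos: "1 + exp (- l * (x \<bullet> b)) > 0" for b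
    by (simp add: add_pos_pos)
  have eq: "(\<lambda>b. logistic_loss b x l) = (\<lambda>b. ln (1 + exp (- l * (x \<bullet> b))))"
    using pos by (simp add: logistic_loss_def logistic_prob_def ln_div fun_eq_iff)
  have prob: "logistic_prob (- l) x \<beta> =
      exp (- l * (x \<bullet> \<beta>)) / (1 + exp (- l * (x \<bullet> \<beta>)))"
    using pos[of \<beta>] unfolding logistic_prob_uminus
    by (simp add: logistic_prob_def field_simps)
  have "((\<lambda>b. ln (1 + exp (- l * (x \<bullet> b)))) has_derivative
      (\<lambda>h. h \<bullet> (- (l * logistic_prob (- l) x \<beta>) *\<^sub>R x))) (at \<beta>)"
    unfolding prob using pos[of \<beta>]
    by (auto intro!: derivative_eq_intros simp: fun_eq_iff inner_commute divide_simps)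
  then show ?thesis
    unfolding gderiv_def eq .
qed

lemmas gradient_logistic_loss = gradient_eqI[OF gderiv_logistic_loss]

lemma gradient_total_loss:
  "gradient (total_loss X y) \<beta> =
    (\<Sum>n\<in>UNIV. - (y $ n * logistic_prob (- y $ n) (row n X) \<beta>) *\<^sub>R row n X)"
proof (rule gradient_eqI)
  show "GDERIV (total_loss X y) \<beta> :>
    (\<Sum>n\<in>UNIV. - (y $ n * logistic_prob (- y $ n) (row n X) \<beta>) *\<^sub>R row n X)"
    unfolding gderiv_def total_loss_def inner_sum_right
    by (intro has_derivative_sum gderiv_logistic_loss[unfolded gderiv_def])
qed

text \<open>At each data point both label gradients are multiples of the same row. With p and q = 1
  - p the probabilities of the two labels, the expectation of the squared coefficients is p q^2 + q
  p^2 = p q.\<close>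

lemma fisher_information_mult_vec:
  fixes X :: "real^'d^'n"
  shows "fisher_information X \<beta> *v v =
    (\<Sum>n\<in>UNIV. (logistic_prob 1 (row n X) \<beta> * logistic_prob (- 1) (row n X) \<beta> *
      (row n X \<bullet> v) / CARD('n)) *\<^sub>R row n X)"
  unfolding fisher_information_def
  by (simp add: sum_matrix_vector_mult scaleR_matrix_vector_assoc[symmetric]
      matrix_vector_mult_add_rdistrib outer_product_mult_vec gradient_logistic_loss
      scaleR_sum_right logistic_prob_uminus flip: scaleR_left.add)
    (simp add: algebra_simps)

text \<open>Both sides of the flow equation are combinations of the independent rows, so their
  coefficients agree. Thus a singular Fisher matrix may leave \<open>v\<close> undetermined, but it
  fixes every \<open>row n X \<bullet> v\<close>. The factor \<open>CARD('n)\<close> arises because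
  the Fisher matrix is an average while the loss is a sum.\<close>

lemma margin_velocity:
  fixes X :: "real^'d^'n"
  assumes "rank X = CARD('n)" and "y $ n \<in> {-1, 1}"
    and "fisher_information X \<beta> *v v = - gradient (total_loss X y) \<beta>"
  shows "y $ n * (row n X \<bullet> v) = CARD('n) * (1 + exp (- (y $ n * (row n X \<bullet> \<beta>))))"
proof -
  let ?p = "\<lambda>l n. logistic_prob l (row n X) \<beta>"
  have "(\<Sum>n\<in>UNIV. (?p 1 n * ?p (- 1) n * (row n X \<bullet> v) / CARD('n)
      - y $ n * ?p (- y $ n) n) *\<^sub>R row n X) = 0"
    using assms(3) unfolding fisher_information_mult_vec gradient_total_loss
    by (simp add: scaleR_left_diff_distrib sum_subtractf sum_negf)
  from sum_scaleR_row_eq_0[OF assms(1) this, of n]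
  have eq: "?p 1 n * ?p (- 1) n * (row n X \<bullet> v) = CARD('n) * (y $ n * ?p (- y $ n) n)"
    by (simp add: field_simps)
  have pos: "?p l n > 0" for l
    by (rule logistic_prob_pos)
  \<comment> \<open>For either label, \<open>?p 1 n * ?p (- 1) n\<close> is the product of the
    probabilities of the observed and the opposite label. The opposite one then cancels against the
    gradient coefficient, leaving the reciprocal of the observed one.\<close>
  have "?p (- y $ n) n * (?p (y $ n) n * (y $ n * (row n X \<bullet> v)))
      = y $ n * (?p 1 n * ?p (- 1) n * (row n X \<bullet> v))"
    using assms(2) by auto
  also have "\<dots> = ?p (- y $ n) n * CARD('n)"
    unfolding eq using assms(2) by auto
  finally have "?p (y $ n) n * (y $ n * (row n X \<bullet> v)) = CARD('n)"
    using pos[of "- y $ n"] by simp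
  then have "y $ n * (row n X \<bullet> v) = CARD('n) * (1 / ?p (y $ n) n)"
    using pos[of "y $ n"] by (simp add: field_simps)
  then show ?thesis
    by (simp add: logistic_prob_def)
qed

lemma softplus_ode_asymptotics:
  fixes m :: "real \<Rightarrow> real"
  assumes "k > 0"
    and "\<And>t. t \<ge> 0 \<Longrightarrow>
      (m has_real_derivative k * (1 + exp (- m t))) (at t within {0..})"
  shows "((\<lambda>t. m t - k * t) \<longlongrightarrow> ln (1 + exp (m 0))) at_top"
proof -
  \<comment> \<open>The function u = 1 + exp m satisfies the linear equation u' = k u, since exp m *
    (1 + exp (- m)) = u. Dividing by exp (k t) therefore gives a constant.\<close>
  define w where "w t = (1 + exp (m t)) * exp (- (k * t))" for t
  have "(w has_real_derivative 0) (at t within {0..})" if "t \<in> {0..}" for t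
    unfolding w_def using that
    by (auto intro!: derivative_eq_intros assms(2) simp: exp_minus field_simps)
  then obtain C where C: "\<And>t. t \<in> {0..} \<Longrightarrow> w t = C"
    using has_field_derivative_zero_constant[of "{0::real..}" w] by auto
  have C0: "C = 1 + exp (m 0)"
    using C[of 0] by (simp add: w_def)
  have m: "m t - k * t = ln (C - exp (- (k * t)))" if "t \<ge> 0" for t
  proof -
    have "C - exp (- (k * t)) = exp (m t - k * t)"
      using C[of t] that by (simp add: w_def algebra_simps exp_diff exp_minus divide_inverse)
    then show ?thesis by simp
  qed
  have "((\<lambda>t. exp (- (k * t))) \<longlongrightarrow> 0) at_top"
    using assms(1) by real_asymp
  \<comment> \<open>Continuity of \<open>ln\<close> applies at the limit because C = 1 + exp (m 0)
    is positive.\<close>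
  then have "((\<lambda>t. ln (C - exp (- (k * t)))) \<longlongrightarrow> ln (C - 0)) at_top"
    by (intro tendsto_intros) (simp_all add: C0 add_pos_pos less_imp_neq[symmetric])
  moreover have "\<forall>\<^sub>F t in at_top. ln (C - exp (- (k * t))) = m t - k * t"
    using eventually_ge_at_top[of 0] by eventually_elim (simp add: m)
  ultimately show ?thesis
    by (simp add: C0 tendsto_cong)
qed

theorem theorem3:
  fixes X :: "real^'d^'n" and y :: "real^'n" and \<beta> :: "real \<Rightarrow> real^'d"
  assumes "CARD('n) < CARD('d)"
    and "rank X = CARD('n)"
    and "\<forall>n. y $ n \<in> {-1, 1}"
    and "linearly_separable X y"
    and "natural_gradient_flow X y \<beta>"
  shows "\<exists>\<alpha>>0. \<exists>c :: real^'n.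
    ((\<lambda>t. X *v \<beta> t - ((\<alpha> * t) *\<^sub>R y + c)) \<longlongrightarrow> 0) at_top"
proof -
  define k where "k = real CARD('n)"
  have k: "k > 0" by (simp add: k_def)
  define m where "m n t = y $ n * (row n X \<bullet> \<beta> t)" for n t
  define L where "L n = ln (1 + exp (m n 0))" for n
  have sq: "y $ n * y $ n = 1" for n
    using assms(3) by (metis insert_iff mult_1 mult_minus1 minus_minus empty_iff)
  have "(m n has_real_derivative k * (1 + exp (- m n t))) (at t within {0..})"
    if t: "t \<ge> 0" for n t
  proof -
    obtain v where v: "(\<beta> has_vector_derivative v) (at t within {0..})"
      and F: "fisher_information X (\<beta> t) *v v = - gradient (total_loss X y) (\<beta> t)"
      using assms(5) t unfolding natural_gradient_flow_def by blast
    have "(m n has_vector_derivative y $ n * (row n X \<bullet> v)) (at t within {0..})"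
      unfolding m_def
      by (intro has_vector_derivative_mult_right
          bounded_linear.has_vector_derivative[OF bounded_linear_inner_right] v)
    also have "y $ n * (row n X \<bullet> v) = k * (1 + exp (- m n t))"
      using margin_velocity[OF assms(2) _ F, of n] assms(3) by (simp add: k_def m_def)
    finally show ?thesis
      by (simp add: has_real_derivative_iff_has_vector_derivative)
  qed
  then have "((\<lambda>t. m n t - k * t) \<longlongrightarrow> L n) at_top" for n
    unfolding L_def by (intro softplus_ode_asymptotics k)
  \<comment> \<open>Multiplying by the label turns margins back into logits, as its square is 1.
    Hence the slope is \<open>k\<close> times the label and the offset is
    \<open>y $ n * L n\<close>.\<close>
  then have lim: "((\<lambda>t. y $ n * (m n t - k * t - L n)) \<longlongrightarrow> y $ n * (L n - L n)) at_top" for n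
    by (intro tendsto_intros)
  have "((\<lambda>t. X *v \<beta> t - ((k * t) *\<^sub>R y + (\<chi> n. y $ n * L n))) \<longlongrightarrow> 0) at_top"
  proof (rule vec_tendstoI)
    fix n
    have "(X *v \<beta> t - ((k * t) *\<^sub>R y + (\<chi> n. y $ n * L n))) $ n
        = y $ n * (m n t - k * t - L n)" for t
    proof -
      have "(X *v \<beta> t) $ n = y $ n * m n t"
        using sq[of n] by (simp add: m_def matrix_mult_dot row_def flip: mult.assoc)
      then show ?thesis by (simp add: algebra_simps)
    qed
    then show "((\<lambda>t. (X *v \<beta> t - ((k * t) *\<^sub>R y + (\<chi> n. y $ n * L n))) $ n)
        \<longlongrightarrow> (0::real^'n) $ n) at_top"
      using lim[of n] by simp
  qed
  then show ?thesis
    using k by blast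
qed

end
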